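(* Let $\rho_i:\mathcal W_>\to\operatorname{End}V_i$, $i=1,2$, be two representations of the Lie algebra $\mathcal W_>$, and consider the product representation $\rho=\rho_1\otimes1+1\otimes\rho_2:\mathcal W_>\to\operatorname{End}(V_1\otimes V_2)$. Let $\sum_{j=1}^rf_{1,j}\otimes f_{2,j}\in V_1\otimes V_2$, and assume that for each $i\in\{1,2\}$ the vectors $f_{i,1},\dots,f_{i,r}\in V_i$ are linearly independent. Then $$\rho(L_k)\Big(\sum_{j=1}^rf_{1,j}\otimes f_{2,j}\Big)=0\quad\text{for all }k\ge-1$$ if and only if $$\rho_i(L_k)(f_{i,j})=0\quad\text{for all }i\in\{1,2\},\ j\in\{1,\dots,r\}\text{ and }k\ge-1 .$$
   Context: $\mathcal W_>$ is the complex Lie algebra with basis $\{L_k\}_{k\ge-1}$ and bracket $[L_i,L_j]=(i-j)L_{i+j}$. $V_1,V_2$ are complex vector spaces (possibly infinite dimensional). *)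

theory Defs
  imports Complex_Main "HOL-Library.Poly_Mapping"
begin

class complex_vector = ab_group_add +
  fixes scaleC :: "complex \<Rightarrow> 'a \<Rightarrow> 'a"  (infixr "*\<^sub>C" 75)
  assumes scaleC_add_right: "a *\<^sub>C (x + y) = a *\<^sub>C x + a *\<^sub>C y"
    and scaleC_add_left: "(a + b) *\<^sub>C x = a *\<^sub>C x + b *\<^sub>C x"
    and scaleC_scaleC: "a *\<^sub>C b *\<^sub>C x = (a * b) *\<^sub>C x"
    and scaleC_one: "1 *\<^sub>C x = x"

global_interpretation complex_vector:
  vector_space "scaleC :: complex \<Rightarrow> 'a \<Rightarrow> 'a::complex_vector"
  by standard (simp_all add: scaleC_add_right scaleC_add_left scaleC_scaleC scaleC_one)

abbreviation clinear :: "('a::complex_vector \<Rightarrow> 'b::complex_vector) \<Rightarrow> bool"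
  where "clinear \<equiv> Vector_Spaces.linear scaleC scaleC"

lemma clinearI:
  assumes "\<And>x y. f (x + y) = f x + f y" "\<And>c x. f (c *\<^sub>C x) = c *\<^sub>C f x"
  shows "clinear f"
  by standard (use assms in auto)

lemma clinearD:
  assumes "clinear f"
  shows "f (x + y) = f x + f y" "f (c *\<^sub>C x) = c *\<^sub>C f x" "f 0 = 0" "f (x - y) = f x - f y"
proof -
  interpret Vector_Spaces.linear scaleC scaleC f by fact
  show "f (x + y) = f x + f y" "f (c *\<^sub>C x) = c *\<^sub>C f x" "f 0 = 0" "f (x - y) = f x - f y"
    by (simp_all add: add scale diff)
qed

instantiation complex :: complex_vector
begin
definition scaleC_complex :: "complex \<Rightarrow> complex \<Rightarrow> complex" where
  "scaleC_complex c z = c * z"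
instance
  by standard (simp_all add: scaleC_complex_def algebra_simps)
end

instantiation poly_mapping :: (type, complex_vector) complex_vector
begin
definition scaleC_poly_mapping :: "complex \<Rightarrow> ('a \<Rightarrow>\<^sub>0 'b) \<Rightarrow> ('a \<Rightarrow>\<^sub>0 'b)" where
  "scaleC_poly_mapping c = Poly_Mapping.map (scaleC c)"
lemma lookup_scaleC: "Poly_Mapping.lookup (c *\<^sub>C p) k = c *\<^sub>C Poly_Mapping.lookup p k"
  by (simp add: scaleC_poly_mapping_def map.rep_eq when_def)
instance
  by standard
    (simp_all add: poly_mapping_eq_iff fun_eq_iff lookup_scaleC lookup_add
      scaleC_add_right scaleC_add_left scaleC_scaleC scaleC_one)
end

text \<open>Linear extension of a map \<open>g\<close> on the index set \<open>'a\<close> to the free vector space on \<open>'a\<close>.\<close>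

definition free_lift :: "('a \<Rightarrow> 'b::complex_vector) \<Rightarrow> ('a \<Rightarrow>\<^sub>0 complex) \<Rightarrow> 'b" where
  "free_lift g p = (\<Sum>a\<in>Poly_Mapping.keys p. Poly_Mapping.lookup p a *\<^sub>C g a)"

lemma free_lift_superset:
  assumes "finite A" "Poly_Mapping.keys p \<subseteq> A"
  shows "free_lift g p = (\<Sum>a\<in>A. Poly_Mapping.lookup p a *\<^sub>C g a)"
  unfolding free_lift_def
  by (rule sum.mono_neutral_left) (use assms in \<open>auto simp: in_keys_iff\<close>)

lemma free_lift_clinear: "clinear (free_lift g)"
proof (rule clinearI)
  fix p q :: "'a \<Rightarrow>\<^sub>0 complex" and c
  let ?A = "Poly_Mapping.keys p \<union> Poly_Mapping.keys q"
  have "free_lift g (p + q) = (\<Sum>a\<in>?A. Poly_Mapping.lookup (p + q) a *\<^sub>C g a)"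
    by (rule free_lift_superset) (use keys_add[of p q] in auto)
  also have "\<dots> = (\<Sum>a\<in>?A. Poly_Mapping.lookup p a *\<^sub>C g a) + (\<Sum>a\<in>?A. Poly_Mapping.lookup q a *\<^sub>C g a)"
    by (simp add: lookup_add scaleC_add_left sum.distrib)
  also have "\<dots> = free_lift g p + free_lift g q"
    by (simp add: free_lift_superset[where A = ?A])
  finally show "free_lift g (p + q) = free_lift g p + free_lift g q" .
  have "free_lift g (c *\<^sub>C p) = (\<Sum>a\<in>Poly_Mapping.keys p. Poly_Mapping.lookup (c *\<^sub>C p) a *\<^sub>C g a)"
    by (rule free_lift_superset) (auto simp: in_keys_iff lookup_scaleC)
  then show "free_lift g (c *\<^sub>C p) = c *\<^sub>C free_lift g p"
    by (simp add: free_lift_def lookup_scaleC complex_vector.scale_sum_right scaleC_complex_def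
        complex_vector.scale_scale mult.commute)
qed

lemmas free_lift_lin = clinearD[OF free_lift_clinear]

lemma free_lift_single [simp]: "free_lift g (Poly_Mapping.single a c) = c *\<^sub>C g a"
  by (cases "c = 0") (simp_all add: free_lift_def)

lemma free_lift_fun_add: "free_lift (\<lambda>a. g a + h a) p = free_lift g p + free_lift h p"
  by (simp add: free_lift_def scaleC_add_right sum.distrib)

lemma free_lift_fun_scale: "free_lift (\<lambda>a. c *\<^sub>C g a) p = c *\<^sub>C free_lift g p"
  by (simp add: free_lift_def complex_vector.scale_sum_right complex_vector.scale_scale mult.commute)

lemma free_lift_id: "p = free_lift (\<lambda>a. Poly_Mapping.single a 1) p"
proof (rule poly_mapping_eqI)
  fix k
  show "Poly_Mapping.lookup p k = Poly_Mapping.lookup (free_lift (\<lambda>a. Poly_Mapping.single a 1) p) k"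
    by (simp add: free_lift_def lookup_sum lookup_scaleC scaleC_complex_def lookup_single when_def
        if_distrib in_keys_iff cong: if_cong)
qed

text \<open>The tensor product is the free vector space on \<open>'a \<times> 'b\<close> modulo the span of the
  bilinearity relations.\<close>

definition tensor_relators :: "(('a::complex_vector \<times> 'b::complex_vector) \<Rightarrow>\<^sub>0 complex) set" where
  "tensor_relators =
     {Poly_Mapping.single (v + v', w) 1 - Poly_Mapping.single (v, w) 1 - Poly_Mapping.single (v', w) 1
       | v v' w. True} \<union>
     {Poly_Mapping.single (v, w + w') 1 - Poly_Mapping.single (v, w) 1 - Poly_Mapping.single (v, w') 1
       | v w w'. True} \<union>
     {Poly_Mapping.single (c *\<^sub>C v, w) 1 - c *\<^sub>C Poly_Mapping.single (v, w) 1 | c v w. True} \<union>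
     {Poly_Mapping.single (v, c *\<^sub>C w) 1 - c *\<^sub>C Poly_Mapping.single (v, w) 1 | c v w. True}"

definition tensor_eq :: "(('a::complex_vector \<times> 'b::complex_vector) \<Rightarrow>\<^sub>0 complex)
    \<Rightarrow> ('a \<times> 'b \<Rightarrow>\<^sub>0 complex) \<Rightarrow> bool" where
  "tensor_eq p q \<longleftrightarrow> p - q \<in> complex_vector.span tensor_relators"

lemma tensor_eq_equivp:
  "equivp (tensor_eq :: (('a::complex_vector \<times> 'b::complex_vector) \<Rightarrow>\<^sub>0 complex) \<Rightarrow> _)"
  (is "equivp ?eq")
proof (rule equivpI)
  show "reflp ?eq"
    by (rule reflpI) (simp add: tensor_eq_def complex_vector.span_zero)
  show "symp ?eq"
    by (rule sympI) (metis tensor_eq_def complex_vector.span_neg minus_diff_eq)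
  show "transp ?eq"
  proof (rule transpI)
    fix p q r :: "('a \<times> 'b) \<Rightarrow>\<^sub>0 complex"
    assume "tensor_eq p q" "tensor_eq q r"
    then have "(p - q) + (q - r) \<in> complex_vector.span tensor_relators"
      unfolding tensor_eq_def by (rule complex_vector.span_add)
    moreover have "(p - q) + (q - r) = p - r" by (simp add: algebra_simps)
    ultimately show "tensor_eq p r" by (simp only: tensor_eq_def)
  qed
qed

quotient_type (overloaded) ('a, 'b) tensor =
  "(('a::complex_vector \<times> 'b::complex_vector) \<Rightarrow>\<^sub>0 complex)" / tensor_eq
  by (rule tensor_eq_equivp)

instantiation tensor :: (complex_vector, complex_vector) complex_vector
begin
lift_definition zero_tensor :: "('a, 'b) tensor" is 0 .
lift_definition plus_tensor :: "('a, 'b) tensor \<Rightarrow> ('a, 'b) tensor \<Rightarrow> ('a, 'b) tensor" is "(+)"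
proof -
  fix p q r s :: "('a \<times> 'b) \<Rightarrow>\<^sub>0 complex"
  assume "tensor_eq p q" "tensor_eq r s"
  then have "(p - q) + (r - s) \<in> complex_vector.span tensor_relators"
    unfolding tensor_eq_def by (rule complex_vector.span_add)
  then show "tensor_eq (p + r) (q + s)" by (simp only: tensor_eq_def add_diff_add)
qed
lift_definition minus_tensor :: "('a, 'b) tensor \<Rightarrow> ('a, 'b) tensor \<Rightarrow> ('a, 'b) tensor" is "(-)"
proof -
  fix p q r s :: "('a \<times> 'b) \<Rightarrow>\<^sub>0 complex"
  assume "tensor_eq p q" "tensor_eq r s"
  then have "(p - q) - (r - s) \<in> complex_vector.span tensor_relators"
    unfolding tensor_eq_def by (rule complex_vector.span_diff)
  then show "tensor_eq (p - r) (q - s)" by (simp add: tensor_eq_def algebra_simps)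
qed
lift_definition uminus_tensor :: "('a, 'b) tensor \<Rightarrow> ('a, 'b) tensor" is uminus
  unfolding tensor_eq_def by (metis minus_diff_minus complex_vector.span_neg)
lift_definition scaleC_tensor :: "complex \<Rightarrow> ('a, 'b) tensor \<Rightarrow> ('a, 'b) tensor" is scaleC
  unfolding tensor_eq_def
  by (metis complex_vector.scale_right_diff_distrib complex_vector.span_scale)
instance
  by standard
    (transfer, simp add: tensor_eq_def complex_vector.span_zero ac_simps
        scaleC_add_right scaleC_add_left scaleC_scaleC scaleC_one)+
end

lift_definition tensor_prod :: "'a::complex_vector \<Rightarrow> 'b::complex_vector \<Rightarrow> ('a, 'b) tensor"
    (infixr "\<otimes>\<^sub>C" 72)
  is "\<lambda>v w. Poly_Mapping.single (v, w) 1" .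

lemma
  fixes v v' :: "'a::complex_vector" and w w' :: "'b::complex_vector"
  shows tensor_prod_add_left: "(v + v') \<otimes>\<^sub>C w = v \<otimes>\<^sub>C w + v' \<otimes>\<^sub>C w"
    and tensor_prod_add_right: "v \<otimes>\<^sub>C (w + w') = v \<otimes>\<^sub>C w + v \<otimes>\<^sub>C w'"
    and tensor_prod_scale_left: "(c *\<^sub>C v) \<otimes>\<^sub>C w = c *\<^sub>C (v \<otimes>\<^sub>C w)"
    and tensor_prod_scale_right: "v \<otimes>\<^sub>C (c *\<^sub>C w) = c *\<^sub>C (v \<otimes>\<^sub>C w)"
proof -
  have eq: "tensor_eq p (q + r)" if "p - q - r \<in> tensor_relators" for p q r :: "('a \<times> 'b) \<Rightarrow>\<^sub>0 complex"
    using complex_vector.span_base[OF that] by (simp only: tensor_eq_def diff_diff_eq)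
  show "(v + v') \<otimes>\<^sub>C w = v \<otimes>\<^sub>C w + v' \<otimes>\<^sub>C w"
    by transfer (rule eq, unfold tensor_relators_def, blast)
  show "v \<otimes>\<^sub>C (w + w') = v \<otimes>\<^sub>C w + v \<otimes>\<^sub>C w'"
    by transfer (rule eq, unfold tensor_relators_def, blast)
  show "(c *\<^sub>C v) \<otimes>\<^sub>C w = c *\<^sub>C (v \<otimes>\<^sub>C w)"
    by transfer (unfold tensor_eq_def, rule complex_vector.span_base,
        unfold tensor_relators_def, blast)
  show "v \<otimes>\<^sub>C (c *\<^sub>C w) = c *\<^sub>C (v \<otimes>\<^sub>C w)"
    by transfer (unfold tensor_eq_def, rule complex_vector.span_base,
        unfold tensor_relators_def, blast)
qed

text \<open>The linear map on the tensor product induced by \<open>h\<close>. It evaluates \<open>h\<close> on an arbitrary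
  representative, hence it is only meaningful for bilinear \<open>h\<close>.\<close>

definition tensor_lift ::
    "('a::complex_vector \<Rightarrow> 'b::complex_vector \<Rightarrow> 'c::complex_vector) \<Rightarrow> ('a, 'b) tensor \<Rightarrow> 'c" where
  "tensor_lift h t = free_lift (\<lambda>(v, w). h v w) (rep_tensor t)"

lemma tensor_lift_abs:
  fixes h :: "'a::complex_vector \<Rightarrow> 'b::complex_vector \<Rightarrow> 'c::complex_vector"
  assumes l: "\<And>w. clinear (\<lambda>v. h v w)" and r: "\<And>v. clinear (h v)"
  shows "tensor_lift h (abs_tensor p) = free_lift (\<lambda>(v, w). h v w) p"
proof -
  let ?F = "free_lift (\<lambda>(v, w). h v w)"
  have rel: "?F x = 0" if "x \<in> tensor_relators" for x
    using that unfolding tensor_relators_def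
    by (auto simp: free_lift_lin clinearD[OF l] clinearD[OF r] scaleC_one)
  have spn: "?F x = 0" if "x \<in> complex_vector.span tensor_relators" for x
    using that
    by (induction rule: complex_vector.span_induct_alt) (auto simp: free_lift_lin rel)
  have "tensor_eq (rep_tensor (abs_tensor p)) p"
    by (rule Quotient3_rep_abs[OF Quotient3_tensor]) (simp add: tensor_eq_def complex_vector.span_zero)
  then have "?F (rep_tensor (abs_tensor p) - p) = 0"
    unfolding tensor_eq_def by (rule spn)
  then show ?thesis by (simp add: tensor_lift_def free_lift_lin)
qed

lemma tensor_lift_tensor_prod:
  fixes h :: "'a::complex_vector \<Rightarrow> 'b::complex_vector \<Rightarrow> 'c::complex_vector"
  assumes "\<And>w. clinear (\<lambda>v. h v w)" and "\<And>v. clinear (h v)"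
  shows "tensor_lift h (v \<otimes>\<^sub>C w) = h v w"
  by (simp add: tensor_prod.abs_eq tensor_lift_abs[OF assms] scaleC_one)

lemma tensor_lift_clinear:
  fixes h :: "'a::complex_vector \<Rightarrow> 'b::complex_vector \<Rightarrow> 'c::complex_vector"
  assumes "\<And>w. clinear (\<lambda>v. h v w)" and "\<And>v. clinear (h v)"
  shows "clinear (tensor_lift h)"
proof (rule clinearI)
  fix s t :: "('a, 'b) tensor" and c
  obtain p q where st: "s = abs_tensor p" "t = abs_tensor q"
    by (metis Quotient3_abs_rep[OF Quotient3_tensor])
  show "tensor_lift h (s + t) = tensor_lift h s + tensor_lift h t"
    by (simp add: st plus_tensor.abs_eq tensor_lift_abs[OF assms] free_lift_lin)
  show "tensor_lift h (c *\<^sub>C s) = c *\<^sub>C tensor_lift h s"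
    by (simp add: st scaleC_tensor.abs_eq tensor_lift_abs[OF assms] free_lift_lin)
qed

lemma tensor_induct [case_names zero add prod]:
  assumes zero: "P 0" and add: "\<And>s t. P s \<Longrightarrow> P t \<Longrightarrow> P (s + t)" and tensor: "\<And>v w. P (v \<otimes>\<^sub>C w)"
  shows "P t"
proof -
  obtain p where t: "t = abs_tensor p"
    by (metis Quotient3_abs_rep[OF Quotient3_tensor])
  let ?term = "\<lambda>x. Poly_Mapping.lookup p x *\<^sub>C Poly_Mapping.single x 1"
  have single: "P (abs_tensor (c *\<^sub>C Poly_Mapping.single x 1))" for c x
  proof (cases x)
    case (Pair v w)
    have "abs_tensor (c *\<^sub>C Poly_Mapping.single x 1) = (c *\<^sub>C v) \<otimes>\<^sub>C w"
      unfolding Pair by (subst tensor_prod_scale_left)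
        (simp only: tensor_prod.abs_eq scaleC_tensor.abs_eq)
    then show ?thesis using tensor by simp
  qed
  have "P (abs_tensor (sum ?term A))" if "finite A" for A
    using that
  proof induction
    case empty
    then show ?case using zero by (simp add: zero_tensor.abs_eq)
  next
    case (insert x A)
    then have "abs_tensor (sum ?term (insert x A)) = abs_tensor (?term x) + abs_tensor (sum ?term A)"
      by (simp add: plus_tensor.abs_eq)
    then show ?case using add[OF single insert.IH] by simp
  qed
  from this[of "Poly_Mapping.keys p"] show ?thesis
    using free_lift_id[of p] unfolding t by (simp add: free_lift_def)
qed

definition tensor_map ::
    "('a::complex_vector \<Rightarrow> 'c::complex_vector) \<Rightarrow> ('b::complex_vector \<Rightarrow> 'd::complex_vector)
      \<Rightarrow> ('a, 'b) tensor \<Rightarrow> ('c, 'd) tensor" where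
  "tensor_map f g = tensor_lift (\<lambda>v w. f v \<otimes>\<^sub>C g w)"

lemma
  assumes "clinear f" "clinear g"
  shows tensor_map_clinear: "clinear (tensor_map f g)"
    and tensor_map_tensor_prod: "tensor_map f g (v \<otimes>\<^sub>C w) = f v \<otimes>\<^sub>C g w"
proof -
  have l: "clinear (\<lambda>v. f v \<otimes>\<^sub>C g w)" for w
    by (rule clinearI)
      (simp_all add: clinearD[OF assms(1)] tensor_prod_add_left tensor_prod_scale_left)
  have r: "clinear (\<lambda>w. f v \<otimes>\<^sub>C g w)" for v
    by (rule clinearI)
      (simp_all add: clinearD[OF assms(2)] tensor_prod_add_right tensor_prod_scale_right)
  show "clinear (tensor_map f g)"
    unfolding tensor_map_def using l r by (rule tensor_lift_clinear)
  show "tensor_map f g (v \<otimes>\<^sub>C w) = f v \<otimes>\<^sub>C g w"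
    unfolding tensor_map_def using l r by (rule tensor_lift_tensor_prod)
qed

class complex_lie_algebra = complex_vector +
  fixes lie_bracket :: "'a \<Rightarrow> 'a \<Rightarrow> 'a"
  assumes lie_bracket_add_left: "lie_bracket (x + y) z = lie_bracket x z + lie_bracket y z"
    and lie_bracket_add_right: "lie_bracket x (y + z) = lie_bracket x y + lie_bracket x z"
    and lie_bracket_scale_left: "lie_bracket (c *\<^sub>C x) y = c *\<^sub>C lie_bracket x y"
    and lie_bracket_scale_right: "lie_bracket x (c *\<^sub>C y) = c *\<^sub>C lie_bracket x y"
    and lie_bracket_self: "lie_bracket x x = 0"
    and lie_bracket_jacobi:
      "lie_bracket x (lie_bracket y z) + lie_bracket y (lie_bracket z x) +
       lie_bracket z (lie_bracket x y) = 0"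

definition lie_representation ::
    "('g::complex_lie_algebra \<Rightarrow> 'v::complex_vector \<Rightarrow> 'v) \<Rightarrow> bool" where
  "lie_representation \<rho> \<longleftrightarrow>
     (\<forall>x. clinear (\<rho> x)) \<and>
     (\<forall>v. clinear (\<lambda>x. \<rho> x v)) \<and>
     (\<forall>x y v. \<rho> (lie_bracket x y) v = \<rho> x (\<rho> y v) - \<rho> y (\<rho> x v))"

definition tensor_rep ::
    "('g::complex_lie_algebra \<Rightarrow> 'a::complex_vector \<Rightarrow> 'a) \<Rightarrow> ('g \<Rightarrow> 'b::complex_vector \<Rightarrow> 'b)
      \<Rightarrow> 'g \<Rightarrow> ('a, 'b) tensor \<Rightarrow> ('a, 'b) tensor" where
  "tensor_rep \<rho>1 \<rho>2 x t = tensor_map (\<rho>1 x) id t + tensor_map id (\<rho>2 x) t"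

lemma clinear_id: "clinear id"
  by (rule clinearI) simp_all

lemma tensor_rep_clinear:
  assumes "lie_representation \<rho>1" "lie_representation \<rho>2"
  shows "clinear (tensor_rep \<rho>1 \<rho>2 x)"
proof -
  have 1: "clinear (tensor_map (\<rho>1 x) id)" and 2: "clinear (tensor_map id (\<rho>2 x))"
    using assms clinear_id by (auto simp: lie_representation_def intro: tensor_map_clinear)
  show ?thesis
    by (rule clinearI)
      (simp_all add: tensor_rep_def clinearD[OF 1] clinearD[OF 2] scaleC_add_right)
qed

lemma tensor_rep_tensor_prod:
  assumes "lie_representation \<rho>1" "lie_representation \<rho>2"
  shows "tensor_rep \<rho>1 \<rho>2 x (v \<otimes>\<^sub>C w) = \<rho>1 x v \<otimes>\<^sub>C w + v \<otimes>\<^sub>C \<rho>2 x w"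
proof -
  have "clinear (\<rho>1 x)" "clinear (\<rho>2 x)"
    using assms by (simp_all add: lie_representation_def)
  then show ?thesis
    by (simp add: tensor_rep_def tensor_map_tensor_prod clinear_id)
qed

lemma tensor_rep_representation:
  assumes "lie_representation \<rho>1" "lie_representation \<rho>2"
  shows "lie_representation (tensor_rep \<rho>1 \<rho>2)"
proof -
  let ?R = "tensor_rep \<rho>1 \<rho>2"
  note lin = clinearD[OF tensor_rep_clinear[OF assms]]
  note prod = tensor_rep_tensor_prod[OF assms]
  have x1: "clinear (\<lambda>x. \<rho>1 x v)" and x2: "clinear (\<lambda>x. \<rho>2 x w)" for v w
    using assms by (auto simp: lie_representation_def)
  have b1: "\<rho>1 (lie_bracket x y) v = \<rho>1 x (\<rho>1 y v) - \<rho>1 y (\<rho>1 x v)"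
    and b2: "\<rho>2 (lie_bracket x y) w = \<rho>2 x (\<rho>2 y w) - \<rho>2 y (\<rho>2 x w)" for x y v w
    using assms by (auto simp: lie_representation_def)
  have tl: "clinear (\<lambda>v. v \<otimes>\<^sub>C w)" and tr: "clinear (\<lambda>w. v \<otimes>\<^sub>C w)"
    for v :: 'b and w :: 'c
    by (auto intro!: clinearI simp: tensor_prod_add_left tensor_prod_scale_left
        tensor_prod_add_right tensor_prod_scale_right)
  have add: "?R (x + y) t = ?R x t + ?R y t" for x y t
    by (induction t rule: tensor_induct)
      (simp_all add: lin prod clinearD[OF x1] clinearD[OF x2] tensor_prod_add_left
        tensor_prod_add_right algebra_simps)
  have scale: "?R (c *\<^sub>C x) t = c *\<^sub>C ?R x t" for c x t
    by (induction t rule: tensor_induct)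
      (simp_all add: lin prod clinearD[OF x1] clinearD[OF x2] tensor_prod_scale_left
        tensor_prod_scale_right scaleC_add_right)
  have brak: "?R (lie_bracket x y) t = ?R x (?R y t) - ?R y (?R x t)" for x y t
    by (induction t rule: tensor_induct)
      (simp_all add: lin prod b1 b2 clinearD[OF tl] clinearD[OF tr])
  have "clinear (\<lambda>x. ?R x t)" for t
    by (rule clinearI) (rule add, rule scale)
  then show ?thesis
    using tensor_rep_clinear[OF assms] brak by (simp add: lie_representation_def)
qed

typedef witt_pos = "{p :: int \<Rightarrow>\<^sub>0 complex. Poly_Mapping.keys p \<subseteq> {-1..}}"
  morphisms witt_coeffs Abs_witt_pos
  by (rule exI[of _ 0]) simp

setup_lifting type_definition_witt_pos

instantiation witt_pos :: complex_vector
begin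
lift_definition zero_witt_pos :: witt_pos is 0 by simp
lift_definition plus_witt_pos :: "witt_pos \<Rightarrow> witt_pos \<Rightarrow> witt_pos" is "(+)"
  by (rule subset_trans[OF Poly_Mapping.keys_add]) simp
lift_definition minus_witt_pos :: "witt_pos \<Rightarrow> witt_pos \<Rightarrow> witt_pos" is "(-)"
  by (rule subset_trans[OF keys_diff]) simp
lift_definition uminus_witt_pos :: "witt_pos \<Rightarrow> witt_pos" is uminus
  by (auto simp: in_keys_iff subset_iff)
lift_definition scaleC_witt_pos :: "complex \<Rightarrow> witt_pos \<Rightarrow> witt_pos" is scaleC
  by (auto simp: in_keys_iff lookup_scaleC subset_iff)
instance
  by standard
    (simp_all add: zero_witt_pos.rep_eq plus_witt_pos.rep_eq minus_witt_pos.rep_eq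
      uminus_witt_pos.rep_eq scaleC_witt_pos.rep_eq ac_simps
      scaleC_add_right scaleC_add_left scaleC_scaleC scaleC_one flip: witt_coeffs_inject)
end

text \<open>The value \<open>0\<close> for \<open>k < -1\<close> is a dummy. It enters the bracket only through
  \<open>[L\<^sub>-\<^sub>1, L\<^sub>-\<^sub>1]\<close>, where its coefficient is \<open>0\<close>.\<close>

lift_definition witt_L :: "int \<Rightarrow> witt_pos" is
  "\<lambda>k. if -1 \<le> k then Poly_Mapping.single k 1 else 0"
  by simp

lemma witt_coeffs_L: "-1 \<le> k \<Longrightarrow> witt_coeffs (witt_L k) = Poly_Mapping.single k 1"
  by transfer simp

lemma witt_expand: "x = (\<Sum>k\<in>Poly_Mapping.keys (witt_coeffs x).
    Poly_Mapping.lookup (witt_coeffs x) k *\<^sub>C witt_L k)"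
proof -
  have coeffs_sum: "witt_coeffs (sum f A) = (\<Sum>a\<in>A. witt_coeffs (f a))" for f :: "int \<Rightarrow> witt_pos" and A
    by (induction A rule: infinite_finite_induct)
      (simp_all add: zero_witt_pos.rep_eq plus_witt_pos.rep_eq)
  have "witt_coeffs (\<Sum>k\<in>Poly_Mapping.keys (witt_coeffs x).
      Poly_Mapping.lookup (witt_coeffs x) k *\<^sub>C witt_L k) =
    (\<Sum>k\<in>Poly_Mapping.keys (witt_coeffs x).
      Poly_Mapping.lookup (witt_coeffs x) k *\<^sub>C Poly_Mapping.single k 1)"
    unfolding coeffs_sum
    by (rule sum.cong) (use witt_coeffs[of x] in \<open>auto simp: scaleC_witt_pos.rep_eq witt_coeffs_L\<close>)
  also have "\<dots> = witt_coeffs x"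
    using free_lift_id[of "witt_coeffs x"] by (simp add: free_lift_def)
  finally show ?thesis by (simp add: witt_coeffs_inject)
qed

lemma witt_induct [case_names zero add scale L]:
  assumes "P 0" "\<And>x y. P x \<Longrightarrow> P y \<Longrightarrow> P (x + y)" "\<And>c x. P x \<Longrightarrow> P (c *\<^sub>C x)"
    "\<And>k. -1 \<le> k \<Longrightarrow> P (witt_L k)"
  shows "P x"
proof -
  have "P (\<Sum>k\<in>A. Poly_Mapping.lookup (witt_coeffs x) k *\<^sub>C witt_L k)"
    if "finite A" "A \<subseteq> {-1..}" for A
    using that by induction (auto intro: assms)
  from this[OF finite_keys, of "witt_coeffs x"] show ?thesis
    using witt_expand[of x] witt_coeffs[of x] by simp
qed

instantiation witt_pos :: complex_lie_algebra
begin

definition lie_bracket_witt_pos :: "witt_pos \<Rightarrow> witt_pos \<Rightarrow> witt_pos" where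
  "lie_bracket_witt_pos x y =
     (\<Sum>i\<in>Poly_Mapping.keys (witt_coeffs x). \<Sum>j\<in>Poly_Mapping.keys (witt_coeffs y).
        (Poly_Mapping.lookup (witt_coeffs x) i * Poly_Mapping.lookup (witt_coeffs y) j * of_int (i - j))
          *\<^sub>C witt_L (i + j))"

lemma lie_bracket_witt_pos_lift:
  "lie_bracket x y =
     free_lift (\<lambda>i. free_lift (\<lambda>j. of_int (i - j) *\<^sub>C witt_L (i + j)) (witt_coeffs y)) (witt_coeffs x)"
  by (simp add: lie_bracket_witt_pos_def free_lift_def complex_vector.scale_sum_right
      complex_vector.scale_scale mult.assoc)

lemma lie_bracket_witt_L:
  assumes "-1 \<le> i" "-1 \<le> j"
  shows "lie_bracket (witt_L i) (witt_L j) = of_int (i - j) *\<^sub>C witt_L (i + j)"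
  by (simp add: lie_bracket_witt_pos_lift witt_coeffs_L assms scaleC_one)

instance
proof
  fix x y z :: witt_pos and c :: complex
  have addl: "lie_bracket (x + y) z = lie_bracket x z + lie_bracket y z" for x y z :: witt_pos
    by (simp add: lie_bracket_witt_pos_lift plus_witt_pos.rep_eq free_lift_lin)
  have addr: "lie_bracket x (y + z) = lie_bracket x y + lie_bracket x z" for x y z :: witt_pos
    by (simp add: lie_bracket_witt_pos_lift plus_witt_pos.rep_eq free_lift_lin free_lift_fun_add)
  have scl: "lie_bracket (c *\<^sub>C x) y = c *\<^sub>C lie_bracket x y" for c and x y :: witt_pos
    by (simp add: lie_bracket_witt_pos_lift scaleC_witt_pos.rep_eq free_lift_lin)
  have scr: "lie_bracket x (c *\<^sub>C y) = c *\<^sub>C lie_bracket x y" for c and x y :: witt_pos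
    by (simp add: lie_bracket_witt_pos_lift scaleC_witt_pos.rep_eq free_lift_lin free_lift_fun_scale)
  have zl: "lie_bracket 0 x = 0" and zr: "lie_bracket x 0 = 0" for x :: witt_pos
    using addl[of 0 0 x] addr[of x 0 0] by simp_all
  note lin = addl addr scl scr zl zr
  show "lie_bracket (x + y) z = lie_bracket x z + lie_bracket y z"
    "lie_bracket x (y + z) = lie_bracket x y + lie_bracket x z"
    "lie_bracket (c *\<^sub>C x) y = c *\<^sub>C lie_bracket x y"
    "lie_bracket x (c *\<^sub>C y) = c *\<^sub>C lie_bracket x y"
    by (fact lin)+
  have skew_L: "lie_bracket (witt_L i) (witt_L j) + lie_bracket (witt_L j) (witt_L i) = 0"
    if "-1 \<le> i" "-1 \<le> j" for i j
    by (simp add: that lie_bracket_witt_L add.commute[of j i]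
        flip: scaleC_add_left)
  have skew1: "lie_bracket (witt_L i) y + lie_bracket y (witt_L i) = 0" if "-1 \<le> i" for i y
  proof (induction y rule: witt_induct)
    case (add y z)
    have "lie_bracket (witt_L i) (y + z) + lie_bracket (y + z) (witt_L i) =
      (lie_bracket (witt_L i) y + lie_bracket y (witt_L i)) +
      (lie_bracket (witt_L i) z + lie_bracket z (witt_L i))"
      by (simp add: lin)
    then show ?case by (simp add: add)
  qed (simp_all add: lin skew_L that flip: scaleC_add_right)
  have skew: "lie_bracket x y + lie_bracket y x = 0" for x y :: witt_pos
  proof (induction x rule: witt_induct)
    case (add x z)
    have "lie_bracket (x + z) y + lie_bracket y (x + z) =
      (lie_bracket x y + lie_bracket y x) + (lie_bracket z y + lie_bracket y z)"
      by (simp add: lin)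
    then show ?case by (simp add: add)
  qed (simp_all add: lin skew1 flip: scaleC_add_right)
  have "2 *\<^sub>C lie_bracket x x = 0"
    using skew[of x x] scaleC_add_left[of 1 1 "lie_bracket x x"] by (simp add: scaleC_one)
  then show "lie_bracket x x = 0" by simp
  define J where "J x y z = lie_bracket x (lie_bracket y z) + lie_bracket y (lie_bracket z x) +
      lie_bracket z (lie_bracket x y)" for x y z :: witt_pos
  have Jadd: "J (x + x') y z = J x y z + J x' y z" "J x (y + y') z = J x y z + J x y' z"
    "J x y (z + z') = J x y z + J x y z'" for x x' y y' z z'
    by (simp_all add: J_def lin algebra_simps)
  have Jscale: "J (c *\<^sub>C x) y z = c *\<^sub>C J x y z" "J x (c *\<^sub>C y) z = c *\<^sub>C J x y z"
    "J x y (c *\<^sub>C z) = c *\<^sub>C J x y z" "J 0 y z = 0" "J x 0 z = 0" "J x y 0 = 0" for c x y z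
    by (simp_all add: J_def lin scaleC_add_right)
  have nested: "lie_bracket (witt_L i) (lie_bracket (witt_L j) (witt_L k)) =
      of_int ((j - k) * (i - j - k)) *\<^sub>C witt_L (i + j + k)"
    if "-1 \<le> i" "-1 \<le> j" "-1 \<le> k" for i j k
  proof (cases "-1 \<le> j + k")
    case True
    have "lie_bracket (witt_L i) (lie_bracket (witt_L j) (witt_L k)) =
        (of_int (j - k) * of_int (i - (j + k))) *\<^sub>C witt_L (i + (j + k))"
      by (simp only: that True lie_bracket_witt_L scr complex_vector.scale_scale)
    then show ?thesis by (simp only: of_int_mult diff_diff_eq add.assoc)
  next
    case False
    then have "j = k" using that by simp
    then show ?thesis by (simp add: that lie_bracket_witt_L lin)
  qed
  have J_L: "J (witt_L i) (witt_L j) (witt_L k) = 0" if "-1 \<le> i" "-1 \<le> j" "-1 \<le> k" for i j k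
  proof -
    have idx: "j + k + i = i + j + k" "k + i + j = i + j + k" by simp_all
    have "(j - k) * (i - j - k) + (k - i) * (j - k - i) + (i - j) * (k - i - j) = 0"
      by (simp add: algebra_simps)
    then show ?thesis
      unfolding J_def nested[OF that] nested[OF that(2,3,1)] nested[OF that(3,1,2)] idx
      by (simp only: of_int_0 complex_vector.scale_zero_left flip: scaleC_add_left of_int_add)
  qed
  have J1: "J (witt_L i) (witt_L j) z = 0" if "-1 \<le> i" "-1 \<le> j" for i j z
    by (induction z rule: witt_induct) (simp_all add: Jadd Jscale J_L that)
  have J2: "J (witt_L i) y z = 0" if "-1 \<le> i" for i y z
    by (induction y rule: witt_induct) (simp_all add: Jadd Jscale J1 that)
  have "J x y z = 0"
    by (induction x rule: witt_induct) (simp_all add: Jadd Jscale J2)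
  then show "lie_bracket x (lie_bracket y z) + lie_bracket y (lie_bracket z x) +
      lie_bracket z (lie_bracket x y) = 0"
    by (simp add: J_def)
qed

end

lemma
  shows witt_L_inj: "inj_on witt_L {-1..}"
    and witt_L_independent: "complex_vector.independent (witt_L ` {-1..})"
    and witt_L_span: "complex_vector.span (witt_L ` {-1..}) = UNIV"
proof -
  have lookup_L: "Poly_Mapping.lookup (witt_coeffs (witt_L j)) k = (if j = k then 1 else 0)"
    if "-1 \<le> j" for j k
    using that by (simp add: witt_coeffs_L lookup_single when_def)
  show inj: "inj_on witt_L {-1..}"
  proof (rule inj_onI)
    fix i j :: int assume ij: "i \<in> {-1..}" "j \<in> {-1..}" and eq: "witt_L i = witt_L j"
    have "Poly_Mapping.lookup (witt_coeffs (witt_L j)) i = 1"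
      using lookup_L[of i i] ij(1) unfolding eq by simp
    moreover have "Poly_Mapping.lookup (witt_coeffs (witt_L j)) i = (if j = i then 1 else 0)"
      using ij(2) by (intro lookup_L) simp
    ultimately show "i = j" by (cases "j = i") simp_all
  qed
  show "complex_vector.span (witt_L ` {-1..}) = UNIV"
  proof -
    have "x \<in> complex_vector.span (witt_L ` {-1..})" for x
      by (induction x rule: witt_induct)
        (simp_all add: complex_vector.span_zero complex_vector.span_add complex_vector.span_scale
          complex_vector.span_base)
    then show ?thesis by blast
  qed
  show "complex_vector.independent (witt_L ` {-1..})"
  proof (unfold complex_vector.independent_explicit_finite_subsets, intro allI impI ballI)
    fix S w and u :: "witt_pos \<Rightarrow> complex"
    assume S: "S \<subseteq> witt_L ` {-1..}" "finite S" and zero: "(\<Sum>v\<in>S. u v *\<^sub>C v) = 0"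
      and w: "w \<in> S"
    obtain k where k: "w = witt_L k" "k \<in> {-1..}" using S(1) w by blast
    have "Poly_Mapping.lookup (witt_coeffs (\<Sum>v\<in>T. u v *\<^sub>C v)) k =
        (\<Sum>v\<in>T. u v * Poly_Mapping.lookup (witt_coeffs v) k)" for T
      by (induction T rule: infinite_finite_induct)
        (simp_all add: zero_witt_pos.rep_eq plus_witt_pos.rep_eq scaleC_witt_pos.rep_eq
          lookup_add lookup_scaleC scaleC_complex_def)
    from this[of S] have "(\<Sum>v\<in>S. u v * Poly_Mapping.lookup (witt_coeffs v) k) = 0"
      by (simp add: zero zero_witt_pos.rep_eq)
    also have "(\<Sum>v\<in>S. u v * Poly_Mapping.lookup (witt_coeffs v) k) =
        (\<Sum>v\<in>S. if v = witt_L k then u v else 0)"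
    proof (rule sum.cong)
      fix v assume "v \<in> S"
      then obtain j where j: "v = witt_L j" "-1 \<le> j" using S(1) by auto
      have "witt_L j = witt_L k \<longleftrightarrow> j = k" using inj_on_eq_iff[OF inj] j(2) k(2) by simp
      then show "u v * Poly_Mapping.lookup (witt_coeffs v) k = (if v = witt_L k then u v else 0)"
        by (simp add: j(1) lookup_L[OF j(2)])
    qed simp
    finally show "u w = 0" using S(2) w k(1) by simp
  qed
qed

end

theory Submission
  imports Defs
begin

text \<open>Contracting the equation \<open>\<rho>(x)(\<Sum>\<^sub>j f\<^sub>1\<^sub>,\<^sub>j \<otimes> f\<^sub>2\<^sub>,\<^sub>j) = 0\<close> with a functional on one tensor factor
  that is dual to the independent family there shows that the span of the other family is
  invariant under the representation on the other factor. It is finite dimensional, so the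
  annihilator of this span is an ideal of finite codimension in an infinite-dimensional Lie algebra,
  hence nonzero. The Lie algebra is simple: applying \<open>ad L\<^sub>-\<^sub>1\<close> often enough to a nonzero element
  yields a nonzero multiple of \<open>L\<^sub>-\<^sub>1\<close>, and \<open>[L\<^sub>k\<^sub>+\<^sub>1, L\<^sub>-\<^sub>1] = (k + 2) L\<^sub>k\<close>. So everything
  acts by zero on both spans.\<close>

lemma vector_space_pair_scaleC:
  "vector_space_pair (scaleC :: complex \<Rightarrow> 'a \<Rightarrow> 'a::complex_vector)
    (scaleC :: complex \<Rightarrow> 'b \<Rightarrow> 'b::complex_vector)"
  by (simp add: vector_space_pair_def complex_vector.vector_space_axioms)

section \<open>Lowering degrees with L_(-1), and simplicity\<close>

text \<open>By linearity it suffices to use \<open>[L_(-1), L_j] = -(j + 1) L_(j-1)\<close>: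
  identifying L_j with t^(j+1), bracketing with L_(-1) is -d/dt.\<close>

lemma lookup_lie_bracket_witt_L_minus_one:
  assumes "-1 \<le> k"
  shows "Poly_Mapping.lookup (witt_coeffs (lie_bracket (witt_L (-1)) x)) k =
    - of_int (k + 2) * Poly_Mapping.lookup (witt_coeffs x) (k + 1)"
proof (induction x rule: witt_induct)
  case zero
  have "lie_bracket (witt_L (-1)) 0 = 0"
    using lie_bracket_scale_right[of "witt_L (-1)" 0 0] by simp
  then show ?case by (simp add: zero_witt_pos.rep_eq)
next
  case (add x y)
  then show ?case
    by (simp add: lie_bracket_add_right plus_witt_pos.rep_eq lookup_add algebra_simps)
next
  case (scale c x)
  then show ?case
    by (simp add: lie_bracket_scale_right scaleC_witt_pos.rep_eq lookup_scaleC scaleC_complex_def)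
next
  case (L j)
  \<comment> \<open>For j = -1 the bracket formula would involve the dummy
    \<open>witt_L (-2)\<close>, so that case uses that the bracket is alternating.\<close>
  show ?case
  proof (cases "j = -1")
    case True
    then show ?thesis
      using assms by (simp add: lie_bracket_self zero_witt_pos.rep_eq witt_coeffs_L lookup_single when_def)
  next
    case False
    then have "0 \<le> j" using L by simp
    then show ?thesis
      by (auto simp: lie_bracket_witt_L scaleC_witt_pos.rep_eq witt_coeffs_L lookup_scaleC
          scaleC_complex_def lookup_single when_def)
  qed
qed

text \<open>The factor k + 2 is nonzero for k at least -1, so only the degree -1 term is lost, just
  as d/dt kills only constants.\<close>

lemma keys_lie_bracket_witt_L_minus_one:
  "Poly_Mapping.keys (witt_coeffs (lie_bracket (witt_L (-1)) x)) =
    (\<lambda>k. k - 1) ` (Poly_Mapping.keys (witt_coeffs x) - {-1})" (is "?K = ?S")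
proof (intro set_eqI iffI)
  fix k assume k: "k \<in> ?K"
  then have "-1 \<le> k"
    using witt_coeffs[of "lie_bracket (witt_L (-1)) x"] by auto
  with k have "k + 1 \<in> Poly_Mapping.keys (witt_coeffs x) - {-1}"
    using lookup_lie_bracket_witt_L_minus_one[of k x] by (auto simp: in_keys_iff)
  then show "k \<in> ?S" by force
next
  fix k assume "k \<in> ?S"
  then have k: "k + 1 \<in> Poly_Mapping.keys (witt_coeffs x)" "k \<noteq> -2" by auto
  then have ge: "-1 \<le> k" using witt_coeffs[of x] by auto
  have "(of_int (k + 2) :: complex) \<noteq> 0" using k(2) by (simp only: of_int_eq_0_iff)
  with k(1) show "k \<in> ?K"
    by (simp add: in_keys_iff lookup_lie_bracket_witt_L_minus_one[OF ge] del: of_int_add)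
qed

text \<open>Differentiating a nonzero polynomial often enough leaves a nonzero constant, which here
  is a multiple of L_(-1).\<close>

lemma witt_L_minus_one_mem_invariant_subspace:
  assumes I: "complex_vector.subspace I"
    and ad: "\<And>x. x \<in> I \<Longrightarrow> lie_bracket (witt_L (-1)) x \<in> I"
    and "x \<in> I" "x \<noteq> 0"
  shows "witt_L (-1) \<in> I"
proof -
  \<comment> \<open>Induction on a degree bound: n = 0 leaves only degree -1, and one bracket lowers
    the bound by one.\<close>
  have "witt_L (-1) \<in> I"
    if "Poly_Mapping.keys (witt_coeffs x) \<subseteq> {-1..<int n}" "x \<in> I" "x \<noteq> 0" for n x
    using that
  proof (induction n arbitrary: x)
    case 0
    have "Poly_Mapping.keys (witt_coeffs x) \<noteq> {}"
      using \<open>x \<noteq> 0\<close> by (simp add: witt_coeffs_inject flip: zero_witt_pos.rep_eq)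
    moreover have "{-1..<int 0} = {-1::int}" by auto
    ultimately have keys: "Poly_Mapping.keys (witt_coeffs x) = {-1}"
      using 0(1) by (metis subset_singletonD)
    define c where "c = Poly_Mapping.lookup (witt_coeffs x) (-1)"
    have "c \<noteq> 0" using keys by (simp add: c_def flip: in_keys_iff)
    moreover have "x = c *\<^sub>C witt_L (-1)" using witt_expand[of x] by (simp add: keys c_def)
    ultimately have "witt_L (-1) = inverse c *\<^sub>C x"
      by (simp add: complex_vector.scale_scale scaleC_one)
    then show ?case
      using complex_vector.subspace_scale[OF I \<open>x \<in> I\<close>] by simp
  next
    case (Suc n)
    let ?y = "lie_bracket (witt_L (-1)) x"
    show ?case
    proof (cases "?y = 0")
      case False
      have "Poly_Mapping.keys (witt_coeffs ?y) \<subseteq> {-1..<int n}"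
        using Suc.prems(1) unfolding keys_lie_bracket_witt_L_minus_one by fastforce
      then show ?thesis using Suc.IH False ad[OF Suc.prems(2)] by blast
    next
      case True
      \<comment> \<open>Here x is already a multiple of L_(-1), so the induction hypothesis applies
        to x itself.\<close>
      then have "Poly_Mapping.keys (witt_coeffs x) \<subseteq> {-1}"
        using keys_lie_bracket_witt_L_minus_one[of x] by (simp add: zero_witt_pos.rep_eq)
      then have "Poly_Mapping.keys (witt_coeffs x) \<subseteq> {-1..<int n}" by auto
      then show ?thesis using Suc by blast
    qed
  qed
  moreover obtain n where "Poly_Mapping.keys (witt_coeffs x) \<subseteq> {-1..<int n}"
  proof
    \<comment> \<open>The inserted 0 keeps the bound nonnegative, so that \<open>nat\<close> does
      not truncate.\<close>
    let ?M = "Max (insert 0 (Poly_Mapping.keys (witt_coeffs x)))"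
    have "k < int (nat (?M + 1))" if "k \<in> Poly_Mapping.keys (witt_coeffs x)" for k
      using Max_ge[of "insert 0 (Poly_Mapping.keys (witt_coeffs x))" k] that by simp
    then show "Poly_Mapping.keys (witt_coeffs x) \<subseteq> {-1..<int (nat (?M + 1))}"
      using witt_coeffs[of x] by auto
  qed
  ultimately show ?thesis using assms(3,4) by blast
qed

lemma witt_pos_simple:
  assumes I: "complex_vector.subspace I"
    and ad: "\<And>x y. x \<in> I \<Longrightarrow> lie_bracket y x \<in> I"
    and "x \<in> I" "x \<noteq> 0"
  shows "y \<in> (I :: witt_pos set)"
proof (induction y rule: witt_induct)
  case (L k)
  have "witt_L (-1) \<in> I"
    using witt_L_minus_one_mem_invariant_subspace[OF I ad] assms(3,4) by blast
  then have "lie_bracket (witt_L (k + 1)) (witt_L (-1)) \<in> I" by (rule ad)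
  moreover have "lie_bracket (witt_L (k + 1)) (witt_L (-1)) = of_int (k + 2) *\<^sub>C witt_L k"
    using L by (simp add: lie_bracket_witt_L)
  ultimately have "inverse (of_int (k + 2)) *\<^sub>C of_int (k + 2) *\<^sub>C witt_L k \<in> I"
    by (metis complex_vector.subspace_scale[OF I])
  moreover have "(of_int (k + 2) :: complex) \<noteq> 0" using L by (simp only: of_int_eq_0_iff)
  ultimately show ?case
    by (simp add: complex_vector.scale_scale scaleC_one del: of_int_add)
qed (simp_all add: I complex_vector.subspace_0 complex_vector.subspace_add
    complex_vector.subspace_scale)

section \<open>Finite-dimensional invariant subspaces\<close>

text \<open>An injective linear map would carry S to an infinite independent set inside the span of
  a finite one. The kernel vector will supply a nonzero element of an annihilator.\<close>

lemma clinear_into_finite_span_not_injective: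
  fixes f :: "'a::complex_vector \<Rightarrow> 'b::complex_vector" and S :: "'a set"
  assumes f: "clinear f" and T: "finite T" "range f \<subseteq> complex_vector.span T"
    and S: "infinite S" "complex_vector.independent S"
  obtains x where "x \<noteq> 0" "f x = 0"
proof -
  have "\<not> inj f"
  proof
    assume inj: "inj f"
    have "complex_vector.independent (f ` S)"
      by (rule vector_space_pair.linear_independent_injective_image
          [OF vector_space_pair_scaleC f S(2)]) (use inj in \<open>auto intro: inj_on_subset\<close>)
    then have "finite (f ` S)"
      using complex_vector.independent_span_bound[OF T(1)] T(2) by blast
    then show False
      using S(1) finite_imageD inj inj_on_subset by blast
  qed
  then obtain x y where "x \<noteq> y" "f x = f y" by (auto simp: inj_def)
  then show ?thesis using that[of "x - y"] by (simp add: clinearD[OF f])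
qed

lemma infinite_independent_witt_L:
  "infinite (witt_L ` {-1..})" "complex_vector.independent (witt_L ` {-1..})"
  by (simp_all add: finite_image_iff witt_L_inj witt_L_independent infinite_Ici)

lemma witt_pos_finite_dim_rep_trivial:
  fixes \<rho> :: "witt_pos \<Rightarrow> 'v::complex_vector \<Rightarrow> 'v"
  assumes rep: "lie_representation \<rho>" and B: "finite B"
    and inv: "\<And>x b. b \<in> B \<Longrightarrow> \<rho> x b \<in> complex_vector.span B"
    and "b \<in> B"
  shows "\<rho> x b = 0"
proof -
  have lin: "clinear (\<rho> x)" and lin': "clinear (\<lambda>x. \<rho> x v)"
    and bracket: "\<rho> (lie_bracket x y) v = \<rho> x (\<rho> y v) - \<rho> y (\<rho> x v)" for x y v
    using rep by (auto simp: lie_representation_def)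
  define I where "I = {x. \<forall>b\<in>B. \<rho> x b = 0}"
  have I: "complex_vector.subspace I"
    by (simp add: complex_vector.subspace_def I_def clinearD[OF lin'])
  \<comment> \<open>Passing from B to its span makes I an ideal: in
    \<open>\<rho> y (\<rho> x b) - \<rho> x (\<rho> y b)\<close> the inner vector of the second term
    is only known to lie in the span.\<close>
  have kill: "\<rho> x v = 0" if "x \<in> I" "v \<in> complex_vector.span B" for x v
    using that(2)
    by (induction rule: complex_vector.span_induct_alt)
      (use that(1) in \<open>simp_all add: I_def clinearD[OF lin]\<close>)
  have ad: "lie_bracket y x \<in> I" if "x \<in> I" for x y
    using that kill[OF that] inv by (simp add: I_def bracket clinearD[OF lin])
  \<comment> \<open>F x records the action of x on all of B at once, so the kernel of F is
    I.\<close>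
  define F :: "witt_pos \<Rightarrow> 'v \<Rightarrow>\<^sub>0 'v" where "F x = (\<Sum>b\<in>B. Poly_Mapping.single b (\<rho> x b))" for x
  have lookup_F: "Poly_Mapping.lookup (F x) b = (\<rho> x b when b \<in> B)" for x b
    using B by (simp add: F_def lookup_sum lookup_single when_def)
  have F: "clinear F"
    by (rule clinearI)
      (simp_all add: poly_mapping_eq_iff fun_eq_iff lookup_F lookup_add lookup_scaleC
        clinearD[OF lin'] when_def)
  \<comment> \<open>The values of F lie in a direct sum of copies of the span of B, one for each
    element of B; ?T is a finite spanning set of it.\<close>
  let ?T = "(\<lambda>(a, b). Poly_Mapping.single a b) ` (B \<times> B)"
  have "Poly_Mapping.single a v \<in> complex_vector.span ?T" if "a \<in> B" "v \<in> complex_vector.span B" for a v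
    using that(2)
  proof (induction rule: complex_vector.span_induct_alt)
    case base
    then show ?case by (simp add: complex_vector.span_zero)
  next
    case (step c u v)
    have eq: "Poly_Mapping.single a (c *\<^sub>C u + v) =
        c *\<^sub>C Poly_Mapping.single a u + Poly_Mapping.single a v"
      by (simp add: poly_mapping_eq_iff fun_eq_iff lookup_scaleC lookup_add lookup_single when_def)
    have "Poly_Mapping.single a u \<in> complex_vector.span ?T"
      using \<open>a \<in> B\<close> \<open>u \<in> B\<close> by (auto intro!: complex_vector.span_base)
    then show ?case
      unfolding eq by (intro complex_vector.span_add complex_vector.span_scale step.IH)
  qed
  then have "range F \<subseteq> complex_vector.span ?T"
    unfolding F_def using inv by (auto intro!: complex_vector.span_sum)
  then obtain x0 where x0: "x0 \<noteq> 0" "F x0 = 0"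
    using B infinite_independent_witt_L clinear_into_finite_span_not_injective[OF F, of ?T] by auto
  have "x0 \<in> I"
    using lookup_F[of x0] x0(2) unfolding I_def by (auto simp: when_def) metis
  then have "x \<in> I"
    using witt_pos_simple[OF I ad] x0(1) by blast
  then show ?thesis using \<open>b \<in> B\<close> by (simp add: I_def)
qed

section \<open>Contraction of tensors\<close>

text \<open>Prescribe the values on the independent image and extend linearly. Injectivity turns the
  test \<open>v = f j\<close> on vectors into \<open>i = j\<close> on indices.\<close>

lemma dual_functional:
  assumes "complex_vector.independent (f ` J)" "inj_on f J" "j \<in> J"
  obtains \<phi> :: "'a::complex_vector \<Rightarrow> complex"
    where "clinear \<phi>" "\<And>i. i \<in> J \<Longrightarrow> \<phi> (f i) = (if i = j then 1 else 0)"
proof -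
  obtain \<phi> :: "'a \<Rightarrow> complex" where "clinear \<phi>" "\<forall>v\<in>f ` J. \<phi> v = (if v = f j then 1 else 0)"
    using vector_space_pair.linear_independent_extend[OF vector_space_pair_scaleC assms(1),
        of "\<lambda>v. if v = f j then 1 else 0"] by blast
  then show ?thesis using that[of \<phi>] assms(2,3) by (simp add: inj_on_eq_iff)
qed

text \<open>Apply id tensor \<open>\<phi>\<close> with \<open>\<phi>\<close> dual to
  \<open>g j\<close>: the first summands collapse to \<open>u j\<close>, and the second become
  multiples of the \<open>f i\<close>.\<close>

lemma tensor_sum_zero_left_in_span:
  fixes f u :: "'i \<Rightarrow> 'a::complex_vector" and g w :: "'i \<Rightarrow> 'b::complex_vector"
  assumes zero: "(\<Sum>i\<in>J. u i \<otimes>\<^sub>C g i + f i \<otimes>\<^sub>C w i) = 0"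
    and J: "finite J" and g: "complex_vector.independent (g ` J)" "inj_on g J" and j: "j \<in> J"
  shows "u j \<in> complex_vector.span (f ` J)"
proof -
  obtain \<phi> :: "'b \<Rightarrow> complex" where \<phi>: "clinear \<phi>"
    and dual: "\<And>i. i \<in> J \<Longrightarrow> \<phi> (g i) = (if i = j then 1 else 0)"
    using dual_functional[OF g j] by blast
  let ?h = "\<lambda>(v::'a) w. \<phi> w *\<^sub>C v"
  have l: "clinear (\<lambda>v. ?h v w)" for w
    by (rule clinearI) (simp_all add: scaleC_add_right complex_vector.scale_scale mult.commute)
  have r: "clinear (?h v)" for v
    by (rule clinearI)
      (simp_all add: clinearD[OF \<phi>] scaleC_add_left complex_vector.scale_scale scaleC_complex_def)
  interpret C: Vector_Spaces.linear scaleC scaleC "tensor_lift ?h"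
    using l r by (rule tensor_lift_clinear)
  have "0 = tensor_lift ?h (\<Sum>i\<in>J. u i \<otimes>\<^sub>C g i + f i \<otimes>\<^sub>C w i)"
    by (simp add: zero C.zero)
  also have "\<dots> = (\<Sum>i\<in>J. \<phi> (g i) *\<^sub>C u i) + (\<Sum>i\<in>J. \<phi> (w i) *\<^sub>C f i)"
    by (simp add: C.sum C.add tensor_lift_tensor_prod[OF l r] sum.distrib)
  also have "(\<Sum>i\<in>J. \<phi> (g i) *\<^sub>C u i) = (\<Sum>i\<in>J. if i = j then u i else 0)"
    by (rule sum.cong) (simp_all add: dual scaleC_one)
  also have "\<dots> = u j" using J j by simp
  finally have "u j = - (\<Sum>i\<in>J. \<phi> (w i) *\<^sub>C f i)" by (simp add: eq_neg_iff_add_eq_0)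
  then show ?thesis
    by (auto intro!: complex_vector.span_neg complex_vector.span_sum complex_vector.span_scale
        intro: complex_vector.span_base)
qed

text \<open>The flip of the two factors lets the contraction argument serve the second
  representation too.\<close>

lemma tensor_sum_zero_swap:
  fixes f u :: "'i \<Rightarrow> 'a::complex_vector" and g w :: "'i \<Rightarrow> 'b::complex_vector"
  assumes "(\<Sum>i\<in>J. u i \<otimes>\<^sub>C g i + f i \<otimes>\<^sub>C w i) = 0"
  shows "(\<Sum>i\<in>J. w i \<otimes>\<^sub>C f i + g i \<otimes>\<^sub>C u i) = 0"
proof -
  let ?h = "\<lambda>(v::'a) (w::'b). w \<otimes>\<^sub>C v"
  have l: "clinear (\<lambda>v. ?h v w)" and r: "clinear (?h v)" for v w
    by (rule clinearI; simp add: tensor_prod_add_left tensor_prod_add_right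
        tensor_prod_scale_left tensor_prod_scale_right)+
  interpret C: Vector_Spaces.linear scaleC scaleC "tensor_lift ?h"
    using l r by (rule tensor_lift_clinear)
  have "tensor_lift ?h (\<Sum>i\<in>J. u i \<otimes>\<^sub>C g i + f i \<otimes>\<^sub>C w i) = (\<Sum>i\<in>J. w i \<otimes>\<^sub>C f i + g i \<otimes>\<^sub>C u i)"
    by (simp add: C.sum C.add tensor_lift_tensor_prod[OF l r] add.commute)
  then show ?thesis by (simp add: assms C.zero)
qed

lemma tensor_prod_zero [simp]: "0 \<otimes>\<^sub>C w = 0" "v \<otimes>\<^sub>C 0 = 0"
  using tensor_prod_scale_left[of 0 0 w] tensor_prod_scale_right[of v 0 0] by simp_all

theorem theorem2p12:
  fixes \<rho>1 :: "witt_pos \<Rightarrow> 'a::complex_vector \<Rightarrow> 'a"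
    and \<rho>2 :: "witt_pos \<Rightarrow> 'b::complex_vector \<Rightarrow> 'b"
    and f1 :: "nat \<Rightarrow> 'a" and f2 :: "nat \<Rightarrow> 'b" and r :: nat
  assumes "lie_representation \<rho>1" and "lie_representation \<rho>2"
    and "inj_on f1 {1..r}" and "complex_vector.independent (f1 ` {1..r})"
    and "inj_on f2 {1..r}" and "complex_vector.independent (f2 ` {1..r})"
  shows "(\<forall>k\<ge>-1. tensor_rep \<rho>1 \<rho>2 (witt_L k) (\<Sum>j=1..r. f1 j \<otimes>\<^sub>C f2 j) = 0) \<longleftrightarrow>
    (\<forall>k\<ge>-1. \<forall>j\<in>{1..r}. \<rho>1 (witt_L k) (f1 j) = 0 \<and> \<rho>2 (witt_L k) (f2 j) = 0)"
proof -
  let ?t = "\<Sum>j=1..r. f1 j \<otimes>\<^sub>C f2 j"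
  have expand: "tensor_rep \<rho>1 \<rho>2 x ?t =
      (\<Sum>j=1..r. \<rho>1 x (f1 j) \<otimes>\<^sub>C f2 j + f1 j \<otimes>\<^sub>C \<rho>2 x (f2 j))" for x
  proof -
    interpret R: Vector_Spaces.linear scaleC scaleC "tensor_rep \<rho>1 \<rho>2 x"
      using assms(1,2) by (rule tensor_rep_clinear)
    show ?thesis by (simp add: R.sum tensor_rep_tensor_prod assms(1,2))
  qed
  show ?thesis
  proof
    assume L: "\<forall>k\<ge>-1. tensor_rep \<rho>1 \<rho>2 (witt_L k) ?t = 0"
    \<comment> \<open>Linearity in the Lie algebra element extends the hypothesis from the basis to
      every x, as invariance of the spans under the whole algebra requires.\<close>
    have "clinear (\<lambda>x. tensor_rep \<rho>1 \<rho>2 x ?t)"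
      using tensor_rep_representation[OF assms(1,2)] by (simp add: lie_representation_def)
    note lin = clinearD[OF this]
    have "tensor_rep \<rho>1 \<rho>2 x ?t = 0" for x
      by (induction x rule: witt_induct) (use L in \<open>simp_all add: lin del: One_nat_def\<close>)
    then have zero: "(\<Sum>j=1..r. \<rho>1 x (f1 j) \<otimes>\<^sub>C f2 j + f1 j \<otimes>\<^sub>C \<rho>2 x (f2 j)) = 0" for x
      by (simp add: expand del: One_nat_def)
    have "\<rho>1 x (f1 j) \<in> complex_vector.span (f1 ` {1..r})" if "j \<in> {1..r}" for x j
      using tensor_sum_zero_left_in_span[OF zero _ assms(6,5) that] by simp
    then have "\<rho>1 x (f1 j) = 0" if "j \<in> {1..r}" for x j
      using witt_pos_finite_dim_rep_trivial[OF assms(1), of "f1 ` {1..r}"] that by blast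
    moreover have "\<rho>2 x (f2 j) \<in> complex_vector.span (f2 ` {1..r})" if "j \<in> {1..r}" for x j
      using tensor_sum_zero_left_in_span[OF tensor_sum_zero_swap[OF zero] _ assms(4,3) that] by simp
    then have "\<rho>2 x (f2 j) = 0" if "j \<in> {1..r}" for x j
      using witt_pos_finite_dim_rep_trivial[OF assms(2), of "f2 ` {1..r}"] that by blast
    ultimately show "\<forall>k\<ge>-1. \<forall>j\<in>{1..r}. \<rho>1 (witt_L k) (f1 j) = 0 \<and> \<rho>2 (witt_L k) (f2 j) = 0"
      by blast
  next
    assume "\<forall>k\<ge>-1. \<forall>j\<in>{1..r}. \<rho>1 (witt_L k) (f1 j) = 0 \<and> \<rho>2 (witt_L k) (f2 j) = 0"
    then show "\<forall>k\<ge>-1. tensor_rep \<rho>1 \<rho>2 (witt_L k) ?t = 0"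
      by (simp add: expand del: One_nat_def)
  qed
qed

end
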